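(* The function $\mathbf{P}\mapsto W(\mathbf{id},\mathbf{P})^2+W(\mathbf{P},\mathbf{rev})^2$ on the space $\mathcal{P}$ of permutons is minimized by a permuton $\mathbf{P}\sim(X,Y)$ if and only if the law of the pair $\left(\frac{X-Y}{\sqrt2},\frac{X+Y}{\sqrt2}\right)$ is also a permuton. In particular, the Archimedean measure is not the unique minimizer.
   Context: A permuton is a Borel probability measure on $[-1,1]^2$ both of whose marginals are uniform on $[-1,1]$; $\mathcal{P}$ is the set of permutons, and $\mathbf{P}\sim(X,Y)$ means that $\mathbf{P}$ is the law of $(X,Y)$. $W$ is the 2-Wasserstein distance for the Euclidean metric on $[-1,1]^2$: $W(\mu,\nu)^2=\inf\mathbb{E}[\|V-V'\|^2]$ over couplings $(V,V')$ with $V\sim\mu$, $V'\sim\nu$. For $U$ uniform on $[-1,1]$, $\mathbf{id}$ is the law of $(U,U)$ and $\mathbf{rev}$ is the law of $(U,-U)$. The Archimedean measure is the unique probability measure on the plane all of whose projections onto lines through the origin have the uniform distribution on $[-1,1]$; it has density $\left(2\pi\sqrt{1-x^2-y^2}\right)^{-1}dx\,dy$ on the unit disk. *)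

theory Defs
  imports "HOL-Probability.Probability"
begin

definition unif :: "real measure" where
  "unif = uniform_measure lborel {-1..1}"

(* Measures on the square are represented as Borel measures on the whole plane that give full
   mass to the square, so that the law of a rotated pair is a measure on the same space. *)
definition permutons :: "(real \<times> real) measure set" where
  "permutons = {P. sets P = sets borel \<and> prob_space P \<and> emeasure P ({-1..1} \<times> {-1..1}) = 1 \<and>
                   distr P borel fst = unif \<and> distr P borel snd = unif}"

definition couplings ::
  "(real \<times> real) measure \<Rightarrow> (real \<times> real) measure \<Rightarrow> ((real \<times> real) \<times> (real \<times> real)) measure set" where
  "couplings \<mu> \<nu> = {\<pi>. sets \<pi> = sets borel \<and> prob_space \<pi> \<and>
                        distr \<pi> borel fst = \<mu> \<and> distr \<pi> borel snd = \<nu>}"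

(* The norm on real * real is the Euclidean one.  The infimum is taken in ennreal and is at most 8
   for probability measures on the square, so enn2real loses nothing there. *)
definition wasserstein2 :: "(real \<times> real) measure \<Rightarrow> (real \<times> real) measure \<Rightarrow> real" where
  "wasserstein2 \<mu> \<nu> =
     sqrt (enn2real (INF \<pi>\<in>couplings \<mu> \<nu>. \<integral>\<^sup>+ (v, v'). ennreal ((norm (v - v'))\<^sup>2) \<partial>\<pi>))"

definition id_permuton :: "(real \<times> real) measure" where
  "id_permuton = distr unif borel (\<lambda>u. (u, u))"

definition rev_permuton :: "(real \<times> real) measure" where
  "rev_permuton = distr unif borel (\<lambda>u. (u, - u))"

(* The description is proper: the measure on the unit disk with density
   1 / (2 pi sqrt (1 - x^2 - y^2)) has this property, and a measure on the plane is determined by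
   its one-dimensional projections. *)
definition archimedean_measure :: "(real \<times> real) measure" where
  "archimedean_measure =
     (THE A. sets A = sets borel \<and> prob_space A \<and>
             (\<forall>e. norm e = 1 \<longrightarrow> distr A borel (\<lambda>z. z \<bullet> e) = unif))"

definition detour_cost :: "(real \<times> real) measure \<Rightarrow> real" where
  "detour_cost P = (wasserstein2 id_permuton P)\<^sup>2 + (wasserstein2 P rev_permuton)\<^sup>2"

end

theory Submission
  imports Defs
begin

text \<open>
  Put \<open>A = (X + Y) / \<surd>2\<close> and \<open>B = (X - Y) / \<surd>2\<close>. For any coupling of \<open>(U, U)\<close> with \<open>(X, Y)\<close>,
  expanding the square gives \<open>E \<parallel>(U, U) - (X, Y)\<parallel>\<^sup>2 = 4/3 - \<surd>2 (E A\<^sup>2 + 1/3) + \<surd>2 E (A - U)\<^sup>2\<close>, and likewise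
  for \<open>(U, -U)\<close> and \<open>B\<close>. Since \<open>E A\<^sup>2 + E B\<^sup>2 = E X\<^sup>2 + E Y\<^sup>2 = 2/3\<close>, the sum of the two squared distances
  is at least \<open>8/3 - 4\<surd>2/3\<close>, with equality iff \<open>A\<close> and \<open>B\<close> can be coupled arbitrarily closely to uniform
  variables, i.e. are themselves uniform. The Archimedean measure attains the bound. So does the measure
  with density \<open>1 + sgn (x y (x\<^sup>2 - y\<^sup>2))\<close> with respect to it, because the sign is odd under the reflections
  in the two axes and the two diagonals, and hence does not affect the projections onto these four lines.
\<close>

section \<open>The uniform law\<close>

lemma borel_measurable_fst_borel [measurable (raw)]:
  "f \<in> M \<rightarrow>\<^sub>M borel \<Longrightarrow> (\<lambda>x. fst (f x :: real \<times> real)) \<in> M \<rightarrow>\<^sub>M borel"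
  by (rule measurable_compose[OF _ borel_measurable_continuous_onI]) (auto intro: continuous_intros)

lemma borel_measurable_snd_borel [measurable (raw)]:
  "f \<in> M \<rightarrow>\<^sub>M borel \<Longrightarrow> (\<lambda>x. snd (f x :: real \<times> real)) \<in> M \<rightarrow>\<^sub>M borel"
  by (rule measurable_compose[OF _ borel_measurable_continuous_onI]) (auto intro: continuous_intros)

lemma sets_unif [simp, measurable_cong]: "sets unif = sets borel"
  by (simp add: unif_def)

lemma space_unif [simp]: "space unif = UNIV"
  by (simp add: unif_def)

lemma prob_space_unif: "prob_space unif"
  unfolding unif_def by (rule prob_space_uniform_measure) auto

lemma unif_eq_density: "unif = density lborel (\<lambda>x. ennreal (indicator {-1..1} x / 2))"
  unfolding unif_def uniform_measure_def
  by (rule arg_cong[where f = "density lborel"])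
    (auto simp: indicator_def divide_ennreal[of 1 2, simplified])

lemma AE_unif: "AE x in unif. \<bar>x\<bar> \<le> 1"
  unfolding unif_def by (rule AE_uniform_measureI) auto

lemma integral_unif_power2: "(\<integral>x. x\<^sup>2 \<partial>unif) = 1 / 3"
proof -
  have "(\<integral>x. x\<^sup>2 \<partial>unif) = (\<integral>x. (x\<^sup>2 * indicator {-1..1} x) / 2 \<partial>lborel)"
    unfolding unif_eq_density by (subst integral_density) (auto simp: mult_ac)
  also have "\<dots> = 1 / 3"
    using integral_power[of "-1" 1 2] by simp
  finally show ?thesis .
qed

lemma emeasure_unif_singleton: "emeasure unif {x} = 0"
proof -
  have "AE y in lborel. ennreal (indicator {-1..1} y / 2) * indicator {x} y = 0"
    using AE_lborel_singleton[of x] by eventually_elim simp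
  then show ?thesis
    unfolding unif_eq_density
    by (subst emeasure_density) (auto simp: nn_integral_0_iff_AE simp del: ennreal_0)
qed

section \<open>Characteristic functions determine planar measures\<close>

text \<open>The value at 0 of a characteristic function is the total mass, so both measures have the
  same mass \<open>m\<close>. If \<open>m\<close> is 0 both vanish; otherwise dividing by
  \<open>m\<close> gives probability laws, to which Levy's uniqueness theorem applies.\<close>

lemma finite_measure_eqI_char:
  fixes M N :: "real measure"
  assumes "finite_measure M" "finite_measure N"
    and [simp, measurable_cong]: "sets M = sets borel" "sets N = sets borel"
    and char: "\<And>t. char M t = char N t"
  shows "M = N"
proof -
  interpret M: finite_measure M by fact
  interpret N: finite_measure N by fact
  have [simp]: "space M = UNIV" "space N = UNIV"
    using sets_eq_imp_space_eq[OF assms(3)] sets_eq_imp_space_eq[OF assms(4)] by auto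
  define m where "m = measure M UNIV"
  have mN: "m = measure N UNIV"
    using char[of 0] by (simp add: char_def m_def of_real_def)
  show ?thesis
  proof (cases "m = 0")
    case True
    then have "emeasure M UNIV = 0" "emeasure N UNIV = 0"
      using mN by (simp_all add: m_def M.emeasure_eq_measure N.emeasure_eq_measure)
    then have "emeasure M A = 0" "emeasure N A = 0" for A
      by (metis emeasure_space \<open>space M = UNIV\<close> \<open>space N = UNIV\<close> le_zero_eq)+
    then show ?thesis by (intro measure_eqI) auto
  next
    case False
    then have m: "m > 0" by (simp add: m_def zero_less_measure_iff)
    let ?M = "density M (\<lambda>_. ennreal (1 / m))" and ?N = "density N (\<lambda>_. ennreal (1 / m))"
    have "emeasure ?M (space ?M) = 1"
      using m by (simp add: emeasure_density_const M.emeasure_eq_measure m_def[symmetric] ennreal_mult[symmetric])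
    then have "real_distribution ?M"
      by (auto intro!: real_distribution.intro real_distribution_axioms.intro prob_spaceI)
    moreover have "emeasure ?N (space ?N) = 1"
      using m by (simp add: emeasure_density_const N.emeasure_eq_measure mN[symmetric] ennreal_mult[symmetric])
    then have "real_distribution ?N"
      by (auto intro!: real_distribution.intro real_distribution_axioms.intro prob_spaceI)
    moreover have "char ?M t = (1 / m) *\<^sub>R char M t" for t
      using m unfolding char_def by (subst integral_density) auto
    moreover have "char ?N t = (1 / m) *\<^sub>R char N t" for t
      using m unfolding char_def by (subst integral_density) auto
    ultimately have eq: "?M = ?N"
      by (intro Levy_uniqueness) (auto simp: char)
    show ?thesis
    proof (rule measure_eqI)
      fix A assume "A \<in> sets M"
      then have "ennreal (1 / m) * emeasure M A = ennreal (1 / m) * emeasure N A"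
        using arg_cong[OF eq, of "\<lambda>K. emeasure K A"] by (simp add: emeasure_density_const)
      then show "emeasure M A = emeasure N A"
        using m by (simp add: ennreal_mult_cancel_left)
    qed simp
  qed
qed

text \<open>
  Reduction to Levy's theorem on the line, applied twice: weighting by \<open>2 + cos (s x + c)\<close> keeps the
  measures positive, so for each \<open>s\<close> and \<open>c\<close> the weighted second marginals agree; thus for fixed \<open>B\<close> the
  first marginals of the restrictions to \<open>UNIV \<times> B\<close> have the same characteristic function.
\<close>

lemma measure_eqI_char_prod:
  fixes M N :: "(real \<times> real) measure"
  assumes "prob_space M" "prob_space N"
    and [simp, measurable_cong]: "sets M = sets borel" "sets N = sets borel"
    and char: "\<And>s t. (CLINT z|M. iexp (s * fst z + t * snd z)) = (CLINT z|N. iexp (s * fst z + t * snd z))"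
  shows "M = N"
proof -
  interpret M: prob_space M by fact
  interpret N: prob_space N by fact
  have [simp]: "space M = UNIV" "space N = UNIV"
    using sets_eq_imp_space_eq[OF assms(3)] sets_eq_imp_space_eq[OF assms(4)] by auto
  define w where "w s c = (\<lambda>z::real \<times> real. 2 + cos (s * fst z + c))" for s c :: real
  have [measurable]: "w s c \<in> borel_measurable borel" for s c
    unfolding w_def by (intro borel_measurable_continuous_onI continuous_intros)
  have w_bounds: "0 < w s c z" "w s c z \<le> 3" for s c z
    using cos_ge_minus_one[of "s * fst z + c"] cos_le_one[of "s * fst z + c"]
    unfolding w_def by linarith+
  have weighted: "distr (density M (\<lambda>z. ennreal (w s c z))) borel snd =
      distr (density N (\<lambda>z. ennreal (w s c z))) borel snd" for s c
  proof (rule finite_measure_eqI_char)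
    have fin: "finite_measure (distr (density K (\<lambda>z. ennreal (w s c z))) borel snd)"
      if "prob_space K" and [simp, measurable_cong]: "sets K = sets borel" for K :: "(real \<times> real) measure"
    proof -
      interpret K: prob_space K by fact
      have [simp]: "space K = UNIV"
        using sets_eq_imp_space_eq[OF that(2)] by auto
      have "(\<integral>\<^sup>+z. ennreal (w s c z) \<partial>K) \<le> (\<integral>\<^sup>+z. ennreal 3 \<partial>K)"
        by (intro nn_integral_mono ennreal_leI w_bounds)
      also have "\<dots> < \<infinity>"
        by (simp add: K.emeasure_space_1[simplified])
      finally have "emeasure (density K (\<lambda>z. ennreal (w s c z))) UNIV < \<infinity>"
        by (subst emeasure_density) auto
      then show ?thesis
        by (intro finite_measure.finite_measure_distr finite_measureI) auto
    qed
    show "finite_measure (distr (density M (\<lambda>z. ennreal (w s c z))) borel snd)"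
      "finite_measure (distr (density N (\<lambda>z. ennreal (w s c z))) borel snd)"
      by (auto intro!: fin assms)
    fix t
    \<comment> \<open>Writing the cosine as half the sum of two exponentials turns the
      characteristic function of the weighted marginal into a combination of planar ones at
      \<open>(0, t)\<close>, \<open>(s, t)\<close> and \<open>(- s, t)\<close>, where
      \<open>M\<close> and \<open>N\<close> agree.\<close>
    have *: "char (distr (density K (\<lambda>z. ennreal (w s c z))) borel snd) t =
        2 * (CLINT z|K. iexp (0 * fst z + t * snd z))
        + iexp c / 2 * (CLINT z|K. iexp (s * fst z + t * snd z))
        + iexp (- c) / 2 * (CLINT z|K. iexp ((- s) * fst z + t * snd z))"
      if "prob_space K" and [simp, measurable_cong]: "sets K = sets borel" for K :: "(real \<times> real) measure"
    proof -
      interpret K: prob_space K by fact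
      have int_exp: "integrable K (\<lambda>z. iexp (a * fst z + b * snd z))" for a b
        by (rule K.integrable_iexp) auto
      have lin: "(CLINT z|K. 2 * f z + c * g z + d * h z) = 2 * (CLINT z|K. f z) + c * (CLINT z|K. g z) + d * (CLINT z|K. h z)"
        if "integrable K f" "integrable K g" "integrable K h" for f g h :: "real \<times> real \<Rightarrow> complex" and c d
        using that by simp
      have "char (distr (density K (\<lambda>z. ennreal (w s c z))) borel snd) t =
          (CLINT z|K. w s c z *\<^sub>R iexp (t * snd z))"
        unfolding char_def using w_bounds(1)
        by (subst integral_distr) (auto intro!: integral_density simp: less_imp_le)
      also have "\<dots> = (CLINT z|K. 2 * iexp (0 * fst z + t * snd z) + iexp c / 2 * iexp (s * fst z + t * snd z)
          + iexp (- c) / 2 * iexp ((- s) * fst z + t * snd z))"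
        by (intro Bochner_Integration.integral_cong refl)
          (simp add: w_def cos_of_real[symmetric] scaleR_conv_of_real cos_exp_eq algebra_simps exp_add[symmetric]
            add_divide_distrib mult_exp_exp)
      also have "\<dots> = 2 * (CLINT z|K. iexp (0 * fst z + t * snd z))
        + iexp c / 2 * (CLINT z|K. iexp (s * fst z + t * snd z))
        + iexp (- c) / 2 * (CLINT z|K. iexp ((- s) * fst z + t * snd z))"
        by (intro lin int_exp)
      finally show ?thesis .
    qed
    show "char (distr (density M (\<lambda>z. ennreal (w s c z))) borel snd) t =
      char (distr (density N (\<lambda>z. ennreal (w s c z))) borel snd) t"
      using *[OF assms(1,3)] *[OF assms(2,4)] by (simp only: char)
  qed auto
  have rect: "emeasure M (A \<times> B) = emeasure N (A \<times> B)"
    if [measurable]: "A \<in> sets borel" "B \<in> sets borel" for A B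
  proof -
    have w_eq: "(\<integral>z. w s c z * indicator B (snd z) \<partial>M) = (\<integral>z. w s c z * indicator B (snd z) \<partial>N)" for s c
    proof -
      have *: "(\<integral>z. w s c z * indicator B (snd z) \<partial>K) =
          measure (distr (density K (\<lambda>z. ennreal (w s c z))) borel snd) B"
        if [simp, measurable_cong]: "sets K = sets borel" for K :: "(real \<times> real) measure"
      proof -
        have [simp]: "space K = UNIV"
          using sets_eq_imp_space_eq[OF that] by auto
        have "(\<integral>z. w s c z * indicator B (snd z) \<partial>K) =
            (\<integral>z. indicator B z \<partial>(distr (density K (\<lambda>z. ennreal (w s c z))) borel snd))"
          using w_bounds(1)
          by (subst integral_distr) (auto simp: integral_density less_imp_le)
        then show ?thesis by simp
      qed
      show ?thesis unfolding *[OF assms(3)] *[OF assms(4)] weighted ..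
    qed
    have int: "integrable K (\<lambda>z. f z * indicator B (snd z) :: real)"
      if "prob_space K" and [simp, measurable_cong]: "sets K = sets borel"
      and [measurable]: "f \<in> borel_measurable borel" and "\<And>z. \<bar>f z\<bar> \<le> 3"
      for K :: "(real \<times> real) measure" and f
    proof -
      interpret K: prob_space K by fact
      show ?thesis using that(4)
        by (intro K.integrable_const_bound[of _ 3]) (auto simp: abs_mult indicator_def)
    qed
    \<comment> \<open>At \<open>s = c = 0\<close> the weight is the constant 3, so the masses of
      \<open>UNIV \<times> B\<close> agree.\<close>
    have one: "(\<integral>z. indicator B (snd z) \<partial>M) = (\<integral>z. indicator B (snd z) \<partial>N :: real)"
      using w_eq[of 0 0] by (simp add: w_def)
    have cos_eq: "(\<integral>z. cos (s * fst z + c) * indicator B (snd z) \<partial>M) =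
        (\<integral>z. cos (s * fst z + c) * indicator B (snd z) \<partial>N)" for s c
    proof -
      have *: "(\<integral>z. w s c z * indicator B (snd z) \<partial>K) =
          2 * (\<integral>z. indicator B (snd z) \<partial>K) + (\<integral>z. cos (s * fst z + c) * indicator B (snd z) \<partial>K)"
        if "prob_space K" and [simp, measurable_cong]: "sets K = sets borel" for K :: "(real \<times> real) measure"
      proof -
        have "integrable K (\<lambda>z. 1 * indicator B (snd z) :: real)"
          by (rule int[OF that]) auto
        moreover have "integrable K (\<lambda>z. cos (s * fst z + c) * indicator B (snd z))"
          by (rule int[OF that]) (auto intro!: order_trans[OF abs_cos_le_one])
        ultimately show ?thesis
          unfolding w_def distrib_right by simp
      qed
      show ?thesis
        using w_eq[of s c] unfolding *[OF assms(1,3)] *[OF assms(2,4)] one by simp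
    qed
    let ?D = "\<lambda>K. distr (density K (\<lambda>z. indicator B (snd z))) borel fst"
    have "?D M = ?D N"
    proof (rule finite_measure_eqI_char)
      have fin: "finite_measure (?D K)"
        if "prob_space K" and [simp, measurable_cong]: "sets K = sets borel" for K :: "(real \<times> real) measure"
      proof -
        interpret K: prob_space K by fact
        have [simp]: "space K = UNIV"
          using sets_eq_imp_space_eq[OF that(2)] by auto
        have "(\<integral>\<^sup>+z. indicator B (snd z) \<partial>K) \<le> (\<integral>\<^sup>+z. 1 \<partial>K)"
          by (intro nn_integral_mono) (simp add: indicator_def)
        also have "\<dots> < \<infinity>"
          by (simp add: K.emeasure_space_1[simplified])
        finally have "emeasure (density K (\<lambda>z. indicator B (snd z))) UNIV < \<infinity>"
          by (subst emeasure_density) auto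
        then show ?thesis
          by (intro finite_measure.finite_measure_distr finite_measureI) auto
      qed
      show "finite_measure (?D M)" "finite_measure (?D N)"
        by (auto intro!: fin assms)
      fix t
      \<comment> \<open>The phases 0 and \<open>- pi / 2\<close> produce the cosine and the sine,
        i.e. the real and imaginary parts of the exponential.\<close>
      have *: "char (?D K) t = complex_of_real (\<integral>z. cos (t * fst z + 0) * indicator B (snd z) \<partial>K)
          + \<i> * complex_of_real (\<integral>z. cos (t * fst z + (- pi / 2)) * indicator B (snd z) \<partial>K)"
        if "prob_space K" and [simp, measurable_cong]: "sets K = sets borel" for K :: "(real \<times> real) measure"
      proof -
        interpret K: prob_space K by fact
        have i: "integrable K (\<lambda>z. cos (t * fst z + c) * indicator B (snd z))" for c
          by (rule int[OF that]) (auto intro!: order_trans[OF abs_cos_le_one])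
        have "char (?D K) t = (CLINT z|K. indicator B (snd z) *\<^sub>R iexp (t * fst z))"
          unfolding char_def
          by (subst integral_distr) (auto simp: integral_density simp flip: ennreal_indicator)
        also have "\<dots> = (CLINT z|K. complex_of_real (cos (t * fst z + 0) * indicator B (snd z))
            + \<i> * complex_of_real (cos (t * fst z + (- pi / 2)) * indicator B (snd z)))"
          by (intro Bochner_Integration.integral_cong refl)
            (auto simp: complex_eq_iff Re_exp Im_exp cos_diff indicator_def)
        also have "\<dots> = complex_of_real (\<integral>z. cos (t * fst z + 0) * indicator B (snd z) \<partial>K)
          + \<i> * complex_of_real (\<integral>z. cos (t * fst z + (- pi / 2)) * indicator B (snd z) \<partial>K)"
          using i[of 0] i[of "- pi / 2"]
          by (subst Bochner_Integration.integral_add)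
            (auto intro!: integrable_of_real integrable_mult_right simp del: of_real_mult)
        finally show ?thesis .
      qed
      show "char (?D M) t = char (?D N) t"
        unfolding *[OF assms(1,3)] *[OF assms(2,4)] cos_eq ..
    qed auto
    then have "emeasure (?D M) A = emeasure (?D N) A" by simp
    moreover have "emeasure (?D K) A = emeasure K (A \<times> B)"
      if [simp, measurable_cong]: "sets K = sets borel" for K :: "(real \<times> real) measure"
    proof -
      have [simp]: "space K = UNIV"
        using sets_eq_imp_space_eq[OF that] by auto
      have "emeasure (?D K) A = (\<integral>\<^sup>+z. indicator B (snd z) * indicator (fst -` A) z \<partial>K)"
        using measurable_sets_borel[of "fst :: real \<times> real \<Rightarrow> real" borel A]
        by (subst emeasure_distr) (auto intro!: emeasure_density)
      also have "\<dots> = (\<integral>\<^sup>+z. indicator (A \<times> B) z \<partial>K)"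
        by (intro nn_integral_cong) (auto simp: indicator_def)
      also have "\<dots> = emeasure K (A \<times> B)"
        by (simp add: borel_Times)
      finally show ?thesis .
    qed
    ultimately show ?thesis by simp
  qed
  show ?thesis
  proof (rule measure_eqI_generator_eq[where E = "{A \<times> B | A B. A \<in> sets borel \<and> B \<in> sets borel}"
        and \<Omega> = UNIV and A = "\<lambda>_. UNIV"])
    show "Int_stable {A \<times> B | A B. A \<in> sets (borel :: real measure) \<and> B \<in> sets (borel :: real measure)}"
      by (rule Int_stable_pair_measure_generator)
    have "sets (borel :: (real \<times> real) measure) = sets ((borel :: real measure) \<Otimes>\<^sub>M (borel :: real measure))"
      by (simp only: borel_prod)
    also have "\<dots> = sigma_sets UNIV {A \<times> B | A B. A \<in> sets borel \<and> B \<in> sets borel}"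
      by (simp add: sets_pair_measure)
    finally show "sets M = sigma_sets UNIV {A \<times> B | A B. A \<in> sets borel \<and> B \<in> sets borel}"
      "sets N = sigma_sets UNIV {A \<times> B | A B. A \<in> sets borel \<and> B \<in> sets borel}"
      by auto
    show "range (\<lambda>_. UNIV) \<subseteq> {A \<times> B | A B. A \<in> sets (borel :: real measure) \<and> B \<in> sets (borel :: real measure)}"
      by (auto intro!: exI[of _ UNIV])
  qed (auto simp: rect)
qed

section \<open>The Archimedean measure\<close>

text \<open>The argument is the squared radius, which is what \<open>nn_integral_rotate\<close>
  preserves. The value 0 from radius 1 on makes this the density of the Archimedean measure on the
  whole plane.\<close>

definition radial_density :: "real \<Rightarrow> real" where
  "radial_density r = (if r < 1 then 1 / (2 * pi * sqrt (1 - r)) else 0)"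

lemma radial_density_nonneg [simp]: "0 \<le> radial_density r"
  by (simp add: radial_density_def)

lemma radial_density_measurable [measurable]: "radial_density \<in> borel_measurable borel"
  unfolding radial_density_def[abs_def] by measurable

text \<open>The antiderivative \<open>arcsin s / (2 * pi)\<close> rises from -1/4 to 1/4. Its
  derivative is unbounded at both endpoints, so the fundamental theorem is used on the open
  interval, with one-sided limits.\<close>

lemma nn_integral_arcsine:
  "(\<integral>\<^sup>+s. ennreal (indicator {-1<..<1} s / (2 * pi * sqrt (1 - s\<^sup>2))) \<partial>lborel) = ennreal (1 / 2)"
proof -
  let ?f = "\<lambda>s::real. 1 / (2 * pi * sqrt (1 - s\<^sup>2))" and ?F = "\<lambda>s. arcsin s / (2 * pi)"
  have pos: "0 < 1 - s\<^sup>2" if "- 1 < s" "s < 1" for s :: real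
    using that by (simp add: abs_square_less_1 abs_less_iff)
  have cont: "continuous (at s within {-1..1}) ?F" if "s \<in> {-1..1}" for s :: real
    using continuous_on_arcsin' that
    by (intro continuous_intros) (auto simp: continuous_on_eq_continuous_within)
  have A: "((?F \<circ> real_of_ereal) \<longlongrightarrow> - 1 / 4) (at_right (ereal (- 1)))"
    using cont[of "-1"]
    by (auto simp: ereal_tendsto_simps1 continuous_within at_within_Icc_at_right)
  have B: "((?F \<circ> real_of_ereal) \<longlongrightarrow> 1 / 4) (at_left (ereal 1))"
    using cont[of "1"]
    by (auto simp: ereal_tendsto_simps1 continuous_within at_within_Icc_at_left)
  have F: "DERIV ?F s :> ?f s" if "ereal (- 1) < ereal s" "ereal s < ereal 1" for s
    using that pos[of s] by (auto intro!: derivative_eq_intros simp: divide_simps)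
  have C: "isCont ?f s" if "ereal (- 1) < ereal s" "ereal s < ereal 1" for s
    using that pos[of s] by (auto intro!: continuous_intros)
  have P: "AE s in lborel. ereal (- 1) < ereal s \<longrightarrow> ereal s < ereal 1 \<longrightarrow> 0 \<le> ?f s"
    using pos by (auto simp: less_imp_le)
  note FTC = interval_integral_FTC_nonneg[of "ereal (-1)" "ereal 1" ?F ?f "-1/4" "1/4", OF _ F C P A B]
  have "(\<integral>\<^sup>+s. ennreal (indicator {-1<..<1} s * ?f s) \<partial>lborel) = ennreal (\<integral>s. indicator {-1<..<1} s * ?f s \<partial>lborel)"
    using FTC(1) pos
    by (intro nn_integral_eq_integral)
      (auto simp: set_integrable_def einterval_def greaterThanLessThan_def greaterThan_def lessThan_def Int_def indicator_def less_imp_le)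
  also have "(\<integral>s. indicator {-1<..<1} s * ?f s \<partial>lborel) = 1 / 2"
    using FTC(2)
    by (simp add: interval_lebesgue_integral_def set_lebesgue_integral_def einterval_def greaterThanLessThan_def greaterThan_def lessThan_def Int_def)
  finally show ?thesis by simp
qed

text \<open>Archimedes' observation: rescaling a chord at height \<open>t\<close> by its half-length
  \<open>c\<close> turns the slice integral into the arcsine integral, whatever \<open>t\<close> is.
  For \<open>\<bar>t\<bar> \<ge> 1\<close> the slice misses the open disk.\<close>

lemma nn_integral_radial_density:
  "(\<integral>\<^sup>+s. ennreal (radial_density (s\<^sup>2 + t\<^sup>2)) \<partial>lborel) = ennreal (indicator {-1<..<1} t / 2)"
proof (cases "\<bar>t\<bar> < 1")
  case True
  define c where "c = sqrt (1 - t\<^sup>2)"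
  have t: "t\<^sup>2 < 1" using True by (simp add: abs_square_less_1)
  then have c: "c > 0" "c\<^sup>2 = 1 - t\<^sup>2" by (simp_all add: c_def)
  \<comment> \<open>The factor \<open>c\<close> from the substitution cancels against the square
    root of \<open>c\<^sup>2 * (1 - s\<^sup>2)\<close>.\<close>
  have *: "c * radial_density ((0 + c * s)\<^sup>2 + t\<^sup>2) = indicator {-1<..<1} s / (2 * pi * sqrt (1 - s\<^sup>2))" for s
  proof -
    have e: "1 - ((0 + c * s)\<^sup>2 + t\<^sup>2) = c\<^sup>2 * (1 - s\<^sup>2)"
      using c(2) by (simp add: power_mult_distrib algebra_simps)
    have "(0 + c * s)\<^sup>2 + t\<^sup>2 < 1 \<longleftrightarrow> 0 < c\<^sup>2 * (1 - s\<^sup>2)"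
      using e by linarith
    also have "\<dots> \<longleftrightarrow> s \<in> {-1<..<1}"
      using c(1) by (auto simp: zero_less_mult_iff abs_square_less_1)
    finally show ?thesis
      unfolding radial_density_def e using c(1) by (auto simp: real_sqrt_mult)
  qed
  have "(\<integral>\<^sup>+s. ennreal (radial_density (s\<^sup>2 + t\<^sup>2)) \<partial>lborel) =
      ennreal \<bar>c\<bar> * (\<integral>\<^sup>+s. ennreal (radial_density ((0 + c * s)\<^sup>2 + t\<^sup>2)) \<partial>lborel)"
    using c by (intro nn_integral_real_affine) auto
  also have "\<dots> = (\<integral>\<^sup>+s. ennreal (c * radial_density ((0 + c * s)\<^sup>2 + t\<^sup>2)) \<partial>lborel)"
    using c by (subst nn_integral_cmult[symmetric]) (auto simp: ennreal_mult)
  also have "\<dots> = ennreal (1 / 2)"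
    unfolding * by (rule nn_integral_arcsine)
  finally show ?thesis using True by (simp add: indicator_def abs_less_iff)
next
  case False
  then have "1 \<le> t\<^sup>2"
    using abs_square_less_1[of t] by simp
  then have "radial_density (s\<^sup>2 + t\<^sup>2) = 0" for s
    using zero_le_power2[of s] unfolding radial_density_def by (smt (verit))
  then show ?thesis using False by (auto simp: indicator_def)
qed

text \<open>
  Rotation invariance of Lebesgue measure, for the rotation \<open>(t, s) = (a x + b y, (x - a t) / b)\<close>, done as
  two affine substitutions in one variable.
\<close>

lemma nn_integral_rotate:
  fixes G :: "real \<Rightarrow> real \<Rightarrow> ennreal"
  assumes [measurable]: "(\<lambda>(u, r). G u r) \<in> borel_measurable (borel \<Otimes>\<^sub>M borel)"
    and ab: "a\<^sup>2 + b\<^sup>2 = 1"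
  shows "(\<integral>\<^sup>+x. \<integral>\<^sup>+y. G (a * x + b * y) (x\<^sup>2 + y\<^sup>2) \<partial>lborel \<partial>lborel) =
    (\<integral>\<^sup>+t. \<integral>\<^sup>+s. G t (s\<^sup>2 + t\<^sup>2) \<partial>lborel \<partial>lborel)"
\<comment> \<open>The substitutions divide by \<open>b\<close>. If \<open>b\<close> is 0 then
  \<open>a\<close> is 1 or -1, and a single rescaling by \<open>a\<close> suffices.\<close>
proof (cases "b = 0")
  case True
  then have a: "\<bar>a\<bar> = 1" "a \<noteq> 0" "a\<^sup>2 = 1" using ab by (auto simp: abs_square_eq_1)
  have "(\<integral>\<^sup>+t. \<integral>\<^sup>+s. G t (s\<^sup>2 + t\<^sup>2) \<partial>lborel \<partial>lborel) =
      ennreal \<bar>a\<bar> * (\<integral>\<^sup>+t. \<integral>\<^sup>+s. G (0 + a * t) (s\<^sup>2 + (0 + a * t)\<^sup>2) \<partial>lborel \<partial>lborel)"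
    using a by (intro nn_integral_real_affine) auto
  then show ?thesis using a True by (simp add: power_mult_distrib add.commute)
next
  case False
  have "(\<integral>\<^sup>+y. G (a * x + b * y) (x\<^sup>2 + y\<^sup>2) \<partial>lborel) =
      ennreal \<bar>1 / b\<bar> * (\<integral>\<^sup>+t. G t (x\<^sup>2 + (- a * x / b + 1 / b * t)\<^sup>2) \<partial>lborel)" for x
    using False
    by (subst nn_integral_real_affine[where c = "1 / b" and t = "- a * x / b"]) (auto simp: algebra_simps)
  then have "(\<integral>\<^sup>+x. \<integral>\<^sup>+y. G (a * x + b * y) (x\<^sup>2 + y\<^sup>2) \<partial>lborel \<partial>lborel) =
      ennreal \<bar>1 / b\<bar> * (\<integral>\<^sup>+x. \<integral>\<^sup>+t. G t (x\<^sup>2 + (- a * x / b + 1 / b * t)\<^sup>2) \<partial>lborel \<partial>lborel)"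
    by (simp add: nn_integral_cmult)
  also have "(\<integral>\<^sup>+x. \<integral>\<^sup>+t. G t (x\<^sup>2 + (- a * x / b + 1 / b * t)\<^sup>2) \<partial>lborel \<partial>lborel) =
      (\<integral>\<^sup>+t. \<integral>\<^sup>+x. G t (x\<^sup>2 + (- a * x / b + 1 / b * t)\<^sup>2) \<partial>lborel \<partial>lborel)"
    by (rule lborel_pair.Fubini') measurable
  also have "(\<lambda>t. \<integral>\<^sup>+x. G t (x\<^sup>2 + (- a * x / b + 1 / b * t)\<^sup>2) \<partial>lborel) =
      (\<lambda>t. ennreal \<bar>b\<bar> * (\<integral>\<^sup>+s. G t (s\<^sup>2 + t\<^sup>2) \<partial>lborel))"
  proof
    fix t
    have sq: "(a * t + b * s)\<^sup>2 + (- a * (a * t + b * s) / b + 1 / b * t)\<^sup>2 = s\<^sup>2 + t\<^sup>2" for s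
    proof -
      have "- a * (a * t + b * s) / b + 1 / b * t = ((1 - a\<^sup>2) * t - a * b * s) / b"
        using False by (simp add: field_simps power2_eq_square)
      also have "1 - a\<^sup>2 = b\<^sup>2" using ab by simp
      also have "(b\<^sup>2 * t - a * b * s) / b = b * t - a * s"
        using False by (simp add: field_simps power2_eq_square)
      finally have e: "- a * (a * t + b * s) / b + 1 / b * t = b * t - a * s" .
      have "(a * t + b * s)\<^sup>2 + (- a * (a * t + b * s) / b + 1 / b * t)\<^sup>2 = (a\<^sup>2 + b\<^sup>2) * (s\<^sup>2 + t\<^sup>2)"
        unfolding e by (simp add: power2_eq_square algebra_simps)
      then show ?thesis by (simp add: ab)
    qed
    \<comment> \<open>Substitute \<open>x = a * t + b * s\<close>. The Jacobian
      \<open>\<bar>b\<bar>\<close> will cancel the \<open>\<bar>1 / b\<bar>\<close> of the first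
      substitution.\<close>
    have "(\<integral>\<^sup>+x. G t (x\<^sup>2 + (- a * x / b + 1 / b * t)\<^sup>2) \<partial>lborel) =
      ennreal \<bar>b\<bar> * (\<integral>\<^sup>+s. G t ((a * t + b * s)\<^sup>2 + (- a * (a * t + b * s) / b + 1 / b * t)\<^sup>2) \<partial>lborel)"
      using False by (intro nn_integral_real_affine) auto
    then show "(\<integral>\<^sup>+x. G t (x\<^sup>2 + (- a * x / b + 1 / b * t)\<^sup>2) \<partial>lborel) =
      ennreal \<bar>b\<bar> * (\<integral>\<^sup>+s. G t (s\<^sup>2 + t\<^sup>2) \<partial>lborel)"
      unfolding sq .
  qed
  finally have "(\<integral>\<^sup>+x. \<integral>\<^sup>+y. G (a * x + b * y) (x\<^sup>2 + y\<^sup>2) \<partial>lborel \<partial>lborel) =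
      (ennreal \<bar>1 / b\<bar> * ennreal \<bar>b\<bar>) * (\<integral>\<^sup>+t. \<integral>\<^sup>+s. G t (s\<^sup>2 + t\<^sup>2) \<partial>lborel \<partial>lborel)"
    by (simp add: nn_integral_cmult mult.assoc)
  then show ?thesis using False by (simp add: ennreal_mult[symmetric])
qed

text \<open>The predicate under the \<open>THE\<close> of \<open>archimedean_measure\<close>, named
  so that existence and uniqueness can be proved separately.\<close>

definition has_uniform_projections :: "(real \<times> real) measure \<Rightarrow> bool" where
  "has_uniform_projections A \<longleftrightarrow> sets A = sets borel \<and> prob_space A \<and>
     (\<forall>e. norm e = 1 \<longrightarrow> distr A borel (\<lambda>z. z \<bullet> e) = unif)"

text \<open>A rotation makes the direction \<open>e\<close> a coordinate axis and keeps the radial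
  density; integrating out the orthogonal coordinate then leaves the constant 1/2 on the open
  interval.\<close>

lemma has_uniform_projections_disk_density:
  "has_uniform_projections (density lborel (\<lambda>z. ennreal (radial_density ((fst z)\<^sup>2 + (snd z)\<^sup>2))))"
    (is "has_uniform_projections ?A")
proof -
  have proj: "distr ?A borel (\<lambda>z. z \<bullet> e) = unif" if "norm e = 1" for e
  proof (rule measure_eqI)
    fix B assume "B \<in> sets (distr ?A borel (\<lambda>z. z \<bullet> e))"
    then have [measurable]: "B \<in> sets borel" by simp
    obtain a b where e: "e = (a, b)" by (cases e)
    have ab: "a\<^sup>2 + b\<^sup>2 = 1" using that by (simp add: e norm_Pair)
    define G where "G u r = (ennreal (radial_density r) * indicator B u)" for u r
    have [measurable]: "(\<lambda>(u, r). G u r) \<in> borel_measurable (borel \<Otimes>\<^sub>M borel)"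
      unfolding G_def by measurable
    have "emeasure (distr ?A borel (\<lambda>z. z \<bullet> e)) B = emeasure ?A ((\<lambda>z. z \<bullet> e) -` B)"
      by (subst emeasure_distr) auto
    also have "\<dots> = (\<integral>\<^sup>+z. ennreal (radial_density ((fst z)\<^sup>2 + (snd z)\<^sup>2)) * indicator ((\<lambda>z. z \<bullet> e) -` B) z \<partial>lborel)"
      using measurable_sets_borel[of "\<lambda>z. z \<bullet> e" borel B] by (intro emeasure_density) auto
    also have "\<dots> = (\<integral>\<^sup>+(x, y). G (a * x + b * y) (x\<^sup>2 + y\<^sup>2) \<partial>(lborel \<Otimes>\<^sub>M lborel))"
      unfolding lborel_prod by (intro nn_integral_cong) (auto simp: G_def e indicator_def mult_ac)
    also have "\<dots> = (\<integral>\<^sup>+x. \<integral>\<^sup>+y. G (a * x + b * y) (x\<^sup>2 + y\<^sup>2) \<partial>lborel \<partial>lborel)"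
      by (subst lborel.nn_integral_fst[symmetric]) auto
    also have "\<dots> = (\<integral>\<^sup>+t. \<integral>\<^sup>+s. G t (s\<^sup>2 + t\<^sup>2) \<partial>lborel \<partial>lborel)"
      by (rule nn_integral_rotate) (use ab in auto)
    also have "\<dots> = (\<integral>\<^sup>+t. ennreal (indicator {-1<..<1} t / 2) * indicator B t \<partial>lborel)"
      by (simp add: G_def nn_integral_multc nn_integral_radial_density)
    also have "\<dots> = (\<integral>\<^sup>+t. ennreal (indicator {-1..1} t / 2) * indicator B t \<partial>lborel)"
      using AE_lborel_singleton[of "-1"] AE_lborel_singleton[of 1]
      by (intro nn_integral_cong_AE, eventually_elim) (auto simp: indicator_def)
    also have "\<dots> = emeasure unif B"
      unfolding unif_eq_density by (rule emeasure_density[symmetric]) auto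
    finally show "emeasure (distr ?A borel (\<lambda>z. z \<bullet> e)) B = emeasure unif B" .
  qed simp
  \<comment> \<open>Total mass 1 is read off from one projection, since pushing forward preserves
    mass.\<close>
  have "prob_space (distr ?A borel (\<lambda>z. z \<bullet> (1, 0)))"
    using proj[of "(1, 0)"] prob_space_unif by (simp add: norm_Pair)
  then have "prob_space ?A"
    by (rule prob_space_distrD[rotated]) auto
  then show ?thesis
    using proj by (simp add: has_uniform_projections_def)
qed

text \<open>The Cramer-Wold argument: the planar characteristic function at \<open>(s, t)\<close> is
  that of the projection onto the direction of \<open>(s, t)\<close>, taken at its length, hence is
  determined by \<open>unif\<close>.\<close>

lemma has_uniform_projections_unique:
  assumes "has_uniform_projections M" "has_uniform_projections N"
  shows "M = N"
proof -
  have [simp, measurable_cong]: "sets M = sets borel" "sets N = sets borel"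
    and prob: "prob_space M" "prob_space N"
    and proj: "\<And>e. norm e = 1 \<Longrightarrow> distr M borel (\<lambda>z. z \<bullet> e) = unif"
      "\<And>e. norm e = 1 \<Longrightarrow> distr N borel (\<lambda>z. z \<bullet> e) = unif"
    using assms by (auto simp: has_uniform_projections_def)
  \<comment> \<open>At the origin there is no direction to normalize, and any unit vector will
    do.\<close>
  have polar: "\<exists>e. norm e = 1 \<and> v = norm v *\<^sub>R e" for v :: "real \<times> real"
  proof (cases "v = 0")
    case True
    obtain e :: "real \<times> real" where "norm e = 1"
      by (rule vector_choose_size[of 1]) (rule zero_le_one)
    then show ?thesis using True by (intro exI[of _ e]) simp
  next
    case False
    then show ?thesis by (intro exI[of _ "sgn v"]) (simp add: norm_sgn sgn_div_norm)
  qed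
  show ?thesis
  proof (rule measure_eqI_char_prod)
    fix s t :: real
    have *: "(CLINT z|K. iexp (s * fst z + t * snd z)) = char unif (norm (s, t))"
      if [simp, measurable_cong]: "sets K = sets borel" and "prob_space K"
        and proj: "\<And>e. norm e = 1 \<Longrightarrow> distr K borel (\<lambda>z. z \<bullet> e) = unif"
      for K :: "(real \<times> real) measure"
    proof -
      obtain e :: "real \<times> real" where e: "norm e = 1" "(s, t) = norm (s, t) *\<^sub>R e"
        using polar[of "(s, t)"] by blast
      have inner: "s * fst z + t * snd z = norm (s, t) * (z \<bullet> e)" for z
      proof -
        have "s * fst z + t * snd z = z \<bullet> (s, t)"
          by (cases z) (simp add: mult.commute)
        also have "\<dots> = norm (s, t) * (z \<bullet> e)"
          by (subst e(2)) simp
        finally show ?thesis .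
      qed
      have "(CLINT z|K. iexp (s * fst z + t * snd z)) = char (distr K borel (\<lambda>z. z \<bullet> e)) (norm (s, t))"
        unfolding char_def inner by (subst integral_distr) auto
      then show ?thesis by (simp only: proj[OF e(1)])
    qed
    show "(CLINT z|M. iexp (s * fst z + t * snd z)) = (CLINT z|N. iexp (s * fst z + t * snd z))"
      using *[OF _ prob(1) proj(1)] *[OF _ prob(2) proj(2)] by simp
  qed (use prob in auto)
qed

lemma has_uniform_projections_archimedean: "has_uniform_projections archimedean_measure"
  unfolding archimedean_measure_def has_uniform_projections_def[symmetric]
  by (rule theI[where P = has_uniform_projections, OF has_uniform_projections_disk_density])
    (rule has_uniform_projections_unique[OF _ has_uniform_projections_disk_density])

lemma sets_archimedean [simp, measurable_cong]: "sets archimedean_measure = sets borel"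
  and prob_space_archimedean: "prob_space archimedean_measure"
  and distr_archimedean: "norm e = 1 \<Longrightarrow> distr archimedean_measure borel (\<lambda>z. z \<bullet> e) = unif"
proof -
  note * = has_uniform_projections_archimedean[unfolded has_uniform_projections_def]
  from * show "sets archimedean_measure = sets borel" by (rule conjunct1)
  from * show "prob_space archimedean_measure" by (elim conjE)
  from * show "distr archimedean_measure borel (\<lambda>z. z \<bullet> e) = unif" if "norm e = 1"
    using that by (elim conjE allE[of _ e] impE)
qed

lemma space_archimedean [simp]: "space archimedean_measure = UNIV"
  using sets_eq_imp_space_eq[OF sets_archimedean] by simp

text \<open>\<open>R'\<close> plays the adjoint of \<open>R\<close>: projecting the image onto
  \<open>e\<close> is projecting the original onto the unit vector \<open>R' e\<close>. So the image
  again has uniform projections, and uniqueness applies.\<close>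

lemma distr_archimedean_isometry:
  assumes [measurable]: "R \<in> borel \<rightarrow>\<^sub>M borel"
    and adj: "\<And>z e. R z \<bullet> e = z \<bullet> R' e" and norm: "\<And>e. norm (R' e) = norm e"
  shows "distr archimedean_measure borel R = archimedean_measure"
proof (rule has_uniform_projections_unique[OF _ has_uniform_projections_archimedean])
  interpret prob_space archimedean_measure by (rule prob_space_archimedean)
  have "distr (distr archimedean_measure borel R) borel (\<lambda>z. z \<bullet> e) = unif" if "norm e = 1" for e
  proof -
    have "distr (distr archimedean_measure borel R) borel (\<lambda>z. z \<bullet> e) =
        distr archimedean_measure borel (\<lambda>z. R z \<bullet> e)"
      by (subst distr_distr) (auto simp: comp_def)
    also have "\<dots> = unif"
      unfolding adj by (rule distr_archimedean) (simp only: norm that)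
    finally show ?thesis .
  qed
  moreover have "prob_space (distr archimedean_measure borel R)"
    by (rule prob_space_distr) measurable
  ultimately show "has_uniform_projections (distr archimedean_measure borel R)"
    unfolding has_uniform_projections_def by simp
qed

section \<open>A second measure with the same projections onto axes and diagonals\<close>

text \<open>The axes and diagonals cut the plane into eight open sectors. This sign alternates from
  each sector to the next and is 0 on the four lines.\<close>

definition octant_sign :: "real \<times> real \<Rightarrow> real" where
  "octant_sign z = sgn (fst z * snd z * ((fst z)\<^sup>2 - (snd z)\<^sup>2))"

lemma octant_sign_measurable [measurable]: "octant_sign \<in> borel_measurable borel"
  unfolding octant_sign_def[abs_def] by measurable

lemma octant_sign_reflections:
  "octant_sign (fst z, - snd z) = - octant_sign z"
  "octant_sign (- fst z, snd z) = - octant_sign z"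
  "octant_sign (snd z, fst z) = - octant_sign z"
  "octant_sign (- snd z, - fst z) = - octant_sign z"
  unfolding octant_sign_def sgn_minus[symmetric]
  by (rule arg_cong[of _ _ sgn], simp add: algebra_simps)+

lemma octant_sign_cases: "octant_sign z = -1 \<or> octant_sign z = 0 \<or> octant_sign z = 1"
  by (auto simp: octant_sign_def sgn_if)

definition octant_measure :: "(real \<times> real) measure" where
  "octant_measure = density archimedean_measure (\<lambda>z. ennreal (1 + octant_sign z))"

lemma sets_octant [simp, measurable_cong]: "sets octant_measure = sets borel"
  by (simp add: octant_measure_def)

text \<open>\<open>R\<close> preserves the Archimedean measure and \<open>l\<close> but flips the
  sign, so the weights \<open>1 + octant_sign z\<close> and \<open>1 - octant_sign z\<close> give
  the preimages under \<open>l\<close> the same mass. Their average is the constant weight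
  1.\<close>

lemma distr_octant:
  fixes l :: "real \<times> real \<Rightarrow> real"
  assumes R: "distr archimedean_measure borel R = archimedean_measure"
    and [measurable]: "R \<in> borel \<rightarrow>\<^sub>M borel" "l \<in> borel_measurable borel"
    and odd: "\<And>z. octant_sign (R z) = - octant_sign z" and l: "\<And>z. l (R z) = l z"
  shows "distr octant_measure borel l = distr archimedean_measure borel l"
proof (rule measure_eqI)
  fix B assume "B \<in> sets (distr octant_measure borel l)"
  then have [measurable]: "B \<in> sets borel" by simp
  have [measurable]: "l -` B \<in> sets borel"
    using measurable_sets_borel[of l borel B] by simp
  let ?I = "\<integral>\<^sup>+z. ennreal (1 + octant_sign z) * indicator B (l z) \<partial>archimedean_measure"
  have "emeasure (distr octant_measure borel l) B = emeasure octant_measure (l -` B)"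
    by (subst emeasure_distr) (auto simp: octant_measure_def)
  also have "\<dots> = ?I"
    unfolding octant_measure_def
    by (subst emeasure_density) (auto intro!: nn_integral_cong simp: indicator_def)
  finally have Q: "emeasure (distr octant_measure borel l) B = ?I" .
  have "?I = (\<integral>\<^sup>+z. ennreal (1 + octant_sign z) * indicator B (l z) \<partial>(distr archimedean_measure borel R))"
    by (simp only: R)
  also have "\<dots> = (\<integral>\<^sup>+z. ennreal (1 - octant_sign z) * indicator B (l z) \<partial>archimedean_measure)"
    by (subst nn_integral_distr) (auto simp: odd l)
  finally have "?I = (\<integral>\<^sup>+z. ennreal (1 - octant_sign z) * indicator B (l z) \<partial>archimedean_measure)" .
  \<comment> \<open>Doubling replaces averaging, so that no subtraction in \<open>ennreal\<close>
    occurs; the two weights add up to 2.\<close>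
  then have "?I + ?I = (\<integral>\<^sup>+z. ennreal (1 + octant_sign z) * indicator B (l z)
      + ennreal (1 - octant_sign z) * indicator B (l z) \<partial>archimedean_measure)"
    by (subst nn_integral_add) auto
  also have "\<dots> = (\<integral>\<^sup>+z. 2 * indicator (l -` B) z \<partial>archimedean_measure)"
  proof (intro nn_integral_cong)
    fix z
    show "ennreal (1 + octant_sign z) * indicator B (l z) + ennreal (1 - octant_sign z) * indicator B (l z)
        = 2 * indicator (l -` B) z"
      using octant_sign_cases[of z] by (auto simp: indicator_def)
  qed
  also have "\<dots> = 2 * emeasure archimedean_measure (l -` B)"
    by (subst nn_integral_cmult) auto
  also have "emeasure archimedean_measure (l -` B) = emeasure (distr archimedean_measure borel l) B"
    by (subst emeasure_distr) auto
  finally have "2 * ?I = 2 * emeasure (distr archimedean_measure borel l) B"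
    by (simp add: mult_2)
  then show "emeasure (distr octant_measure borel l) B = emeasure (distr archimedean_measure borel l) B"
    unfolding Q by (simp add: ennreal_mult_cancel_left)
qed simp

text \<open>Reflections in the axes and diagonals are self-adjoint, so each serves as its own
  \<open>R'\<close>.\<close>

lemma distr_archimedean_reflections:
  "distr archimedean_measure borel (\<lambda>z. (fst z, - snd z)) = archimedean_measure"
  "distr archimedean_measure borel (\<lambda>z. (- fst z, snd z)) = archimedean_measure"
  "distr archimedean_measure borel (\<lambda>z. (snd z, fst z)) = archimedean_measure"
  "distr archimedean_measure borel (\<lambda>z. (- snd z, - fst z)) = archimedean_measure"
proof -
  note borel_measurable_continuous_onI[intro!]
  show "distr archimedean_measure borel (\<lambda>z. (fst z, - snd z)) = archimedean_measure"
    by (rule distr_archimedean_isometry[where R' = "\<lambda>z. (fst z, - snd z)"])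
      (auto intro!: continuous_intros simp: inner_prod_def norm_prod_def)
  show "distr archimedean_measure borel (\<lambda>z. (- fst z, snd z)) = archimedean_measure"
    by (rule distr_archimedean_isometry[where R' = "\<lambda>z. (- fst z, snd z)"])
      (auto intro!: continuous_intros simp: inner_prod_def norm_prod_def)
  show "distr archimedean_measure borel (\<lambda>z. (snd z, fst z)) = archimedean_measure"
    by (rule distr_archimedean_isometry[where R' = "\<lambda>z. (snd z, fst z)"])
      (auto intro!: continuous_intros simp: inner_prod_def norm_prod_def add.commute)
  show "distr archimedean_measure borel (\<lambda>z. (- snd z, - fst z)) = archimedean_measure"
    by (rule distr_archimedean_isometry[where R' = "\<lambda>z. (- snd z, - fst z)"])
      (auto intro!: continuous_intros simp: inner_prod_def norm_prod_def add.commute)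
qed

text \<open>The density of \<open>octant_measure\<close> vanishes where the sign is -1. Were the
  measures equal, the sign would exceed -1 almost everywhere and, by the swap of coordinates, also
  stay below 1. It would then be 0 almost everywhere, although its zero set consists of four null
  lines.\<close>

lemma octant_measure_neq: "octant_measure \<noteq> archimedean_measure"
proof
  assume eq: "octant_measure = archimedean_measure"
  interpret prob_space archimedean_measure by (rule prob_space_archimedean)
  have "AE z in octant_measure. octant_sign z > - 1"
    unfolding octant_measure_def by (subst AE_density) (auto simp: ennreal_eq_0_iff)
  then have pos: "AE z in archimedean_measure. octant_sign z > - 1"
    unfolding eq .
  have "AE z in distr archimedean_measure borel (\<lambda>z. (snd z, fst z)). octant_sign z > - 1"
    unfolding distr_archimedean_reflections by (rule pos)
  then have "AE z in archimedean_measure. octant_sign (snd z, fst z) > - 1"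
    by (subst (asm) AE_distr_iff) auto
  with pos have zero: "AE z in archimedean_measure. octant_sign z = 0"
  proof eventually_elim
    case (elim z)
    then show ?case using octant_sign_cases[of z] by (auto simp: octant_sign_reflections)
  qed
  \<comment> \<open>A line through the origin is the zero set of a projection, whose uniform law has
    no atom at 0.\<close>
  have line: "AE z in archimedean_measure. z \<bullet> e \<noteq> 0" if "norm e = 1" for e
  proof -
    have "AE x in distr archimedean_measure borel (\<lambda>z. z \<bullet> e). x \<noteq> 0"
      unfolding distr_archimedean[OF that]
      by (rule AE_I[OF _ emeasure_unif_singleton[of 0]]) auto
    then show ?thesis by (subst (asm) AE_distr_iff) auto
  qed
  have "norm (1 / sqrt 2, 1 / sqrt 2 :: real) = 1" "norm (1 / sqrt 2, - 1 / sqrt 2 :: real) = 1"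
    by (simp_all add: norm_Pair power_divide)
  note line[OF this(1)] line[OF this(2)]
  moreover have "AE z in archimedean_measure. z \<bullet> (1, 0) \<noteq> 0" "AE z in archimedean_measure. z \<bullet> (0, 1) \<noteq> 0"
    by (auto intro!: line simp: norm_Pair)
  ultimately have "AE z in archimedean_measure. False"
    using zero
  proof eventually_elim
    case (elim z)
    then have "fst z \<noteq> 0" "snd z \<noteq> 0" "fst z + snd z \<noteq> 0" "fst z - snd z \<noteq> 0"
      by (auto simp: inner_prod_def field_simps)
    then have "fst z * snd z * ((fst z + snd z) * (fst z - snd z)) \<noteq> 0" by simp
    then have "octant_sign z \<noteq> 0"
      by (simp add: octant_sign_def sgn_eq_0_iff power2_eq_square algebra_simps)
    then show ?case using elim by simp
  qed
  then show False by simp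
qed

section \<open>Permutons and their diagonal coordinates\<close>

text \<open>Uniform marginals put each coordinate in \<open>{-1..1}\<close> almost surely, which
  gives the square full mass.\<close>

lemma permutonsI:
  assumes [simp, measurable_cong]: "sets P = sets borel" and "prob_space P"
    and "distr P borel fst = unif" "distr P borel snd = unif"
  shows "P \<in> permutons"
proof -
  interpret prob_space P by fact
  have "AE x in distr P borel fst. \<bar>x\<bar> \<le> 1" "AE x in distr P borel snd. \<bar>x\<bar> \<le> 1"
    unfolding assms(3,4) by (rule AE_unif)+
  then have "AE z in P. \<bar>fst z\<bar> \<le> 1" "AE z in P. \<bar>snd z\<bar> \<le> 1"
    by (auto simp: AE_distr_iff)
  then have "AE z in P. z \<in> {-1..1} \<times> {-1..1}"
    by eventually_elim (auto simp: mem_Times_iff)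
  then have "emeasure P ({-1..1} \<times> {-1..1}) = 1"
    by (intro emeasure_eq_1_AE) (auto intro!: borel_closed closed_Times)
  then show ?thesis using assms by (simp add: permutons_def)
qed

text \<open>For \<open>s\<close> equal to 1 or -1 this is the inner product with the unit vector
  along the line \<open>y = s * x\<close>. Keeping \<open>s\<close> as a parameter lets one argument
  serve both diagonals.\<close>

definition diagonal_coord :: "real \<Rightarrow> real \<times> real \<Rightarrow> real" where
  "diagonal_coord s z = (fst z + s * snd z) / sqrt 2"

lemma diagonal_coord_measurable [measurable]: "diagonal_coord s \<in> borel_measurable borel"
  unfolding diagonal_coord_def[abs_def] by measurable

text \<open>The marginals of the rotated law are the laws of the two diagonal coordinates. This
  splits the condition into one half for each of the two transport distances.\<close>

lemma rotated_permuton_iff: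
  assumes "P \<in> permutons"
  shows "distr P borel (\<lambda>(x, y). ((x - y) / sqrt 2, (x + y) / sqrt 2)) \<in> permutons \<longleftrightarrow>
    distr P borel (diagonal_coord (-1)) = unif \<and> distr P borel (diagonal_coord 1) = unif"
proof -
  have [simp, measurable_cong]: "sets P = sets borel" and "prob_space P"
    using assms by (auto simp: permutons_def)
  then interpret prob_space P by simp
  let ?R = "\<lambda>(x, y). ((x - y) / sqrt 2, (x + y) / sqrt 2)"
  have R: "?R = (\<lambda>z. (diagonal_coord (-1) z, diagonal_coord 1 z))"
    by (auto simp: diagonal_coord_def fun_eq_iff)
  have [measurable]: "?R \<in> borel \<rightarrow>\<^sub>M borel"
    unfolding R by (rule borel_measurable_Pair) measurable
  have marg: "distr (distr P borel ?R) borel fst = distr P borel (diagonal_coord (-1))"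
    "distr (distr P borel ?R) borel snd = distr P borel (diagonal_coord 1)"
    by (subst distr_distr; auto simp: comp_def R)+
  have "prob_space (distr P borel ?R)"
    by (rule prob_space_distr) auto
  then show ?thesis
    using marg permutonsI[of "distr P borel ?R"] by (auto simp: permutons_def)
qed

lemma archimedean_permuton: "archimedean_measure \<in> permutons"
  and distr_archimedean_diagonal:
    "distr archimedean_measure borel (diagonal_coord 1) = unif"
    "distr archimedean_measure borel (diagonal_coord (-1)) = unif"
proof -
  have "norm (1 / sqrt 2, 1 / sqrt 2 :: real) = 1" "norm (1 / sqrt 2, - 1 / sqrt 2 :: real) = 1"
    by (simp_all add: norm_Pair power_divide)
  note distr_archimedean[OF this(1)] distr_archimedean[OF this(2)]
  then show "distr archimedean_measure borel (diagonal_coord 1) = unif"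
    "distr archimedean_measure borel (diagonal_coord (-1)) = unif"
    by (simp_all add: diagonal_coord_def[abs_def] inner_prod_def add_divide_distrib diff_divide_distrib)
  show "archimedean_measure \<in> permutons"
    using distr_archimedean[of "(1, 0)"] distr_archimedean[of "(0, 1)"]
    by (intro permutonsI) (auto simp: norm_Pair inner_prod_def prob_space_archimedean)
qed

text \<open>Each of the four coordinates is unchanged by the reflection in its own line, which flips
  the sign: \<open>fst\<close> by the one in the first axis, \<open>snd\<close> by the one in the
  second, the sum by the swap, the difference by the swap with both signs changed.\<close>

lemma octant_permuton: "octant_measure \<in> permutons"
  and distr_octant_diagonal:
    "distr octant_measure borel (diagonal_coord 1) = unif"
    "distr octant_measure borel (diagonal_coord (-1)) = unif"
proof -
  have [measurable]: "(\<lambda>z. (fst z, - snd z)) \<in> (borel :: (real \<times> real) measure) \<rightarrow>\<^sub>M borel"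
    "(\<lambda>z. (- fst z, snd z)) \<in> (borel :: (real \<times> real) measure) \<rightarrow>\<^sub>M borel"
    "(\<lambda>z. (snd z, fst z)) \<in> (borel :: (real \<times> real) measure) \<rightarrow>\<^sub>M borel"
    "(\<lambda>z. (- snd z, - fst z)) \<in> (borel :: (real \<times> real) measure) \<rightarrow>\<^sub>M borel"
    by (auto intro!: borel_measurable_continuous_onI continuous_intros)
  note D = distr_archimedean_reflections[THEN distr_octant]
  have marg: "distr octant_measure borel fst = unif" "distr octant_measure borel snd = unif"
    using archimedean_permuton D(1)[of fst] D(2)[of snd]
    by (simp_all add: octant_sign_reflections permutons_def)
  show "distr octant_measure borel (diagonal_coord 1) = unif"
    using distr_archimedean_diagonal(1) D(3)[of "diagonal_coord 1"]
    by (simp add: octant_sign_reflections diagonal_coord_def add.commute)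
  show "distr octant_measure borel (diagonal_coord (-1)) = unif"
    using distr_archimedean_diagonal(2) D(4)[of "diagonal_coord (-1)"]
    by (simp add: octant_sign_reflections diagonal_coord_def)
  have "prob_space octant_measure"
    using marg(1) prob_space_unif by (intro prob_space_distrD[of fst _ borel]) auto
  then show "octant_measure \<in> permutons"
    using marg by (intro permutonsI) auto
qed

section \<open>Transport to the diagonals\<close>

definition line_permuton :: "real \<Rightarrow> (real \<times> real) measure" where
  "line_permuton s = distr unif borel (\<lambda>u. (u, s * u))"

lemma id_permuton_eq: "id_permuton = line_permuton 1"
  and rev_permuton_eq: "rev_permuton = line_permuton (-1)"
  by (simp_all add: id_permuton_def rev_permuton_def line_permuton_def)

lemma Pair_line_measurable [measurable]: "(\<lambda>u. (u, s * u :: real)) \<in> borel \<rightarrow>\<^sub>M borel"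
  by (auto intro!: borel_measurable_continuous_onI continuous_intros)

lemma sets_line_permuton [simp, measurable_cong]: "sets (line_permuton s) = sets borel"
  by (simp add: line_permuton_def)

lemma prob_space_line_permuton: "prob_space (line_permuton s)"
  unfolding line_permuton_def by (rule prob_space.prob_space_distr[OF prob_space_unif]) auto

text \<open>Exchanging the components maps couplings to couplings at equal cost. This brings both
  terms of \<open>detour_cost\<close> into the form with the line first.\<close>

lemma wasserstein2_commute: "wasserstein2 \<mu> \<nu> = wasserstein2 \<nu> \<mu>"
proof -
  have le: "(INF \<pi>\<in>couplings \<nu> \<mu>. \<integral>\<^sup>+ (v, v'). ennreal ((norm (v - v'))\<^sup>2) \<partial>\<pi>)
      \<le> (INF \<pi>\<in>couplings \<mu> \<nu>. \<integral>\<^sup>+ (v, v'). ennreal ((norm (v - v'))\<^sup>2) \<partial>\<pi>)" for \<mu> \<nu> :: "(real \<times> real) measure"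
  proof (rule INF_mono)
    fix \<pi> assume pi: "\<pi> \<in> couplings \<mu> \<nu>"
    then have [simp, measurable_cong]: "sets \<pi> = sets borel" by (simp add: couplings_def)
    interpret prob_space \<pi> using pi by (simp add: couplings_def)
    have [measurable]: "(\<lambda>z. (snd z, fst z)) \<in> (borel :: ((real \<times> real) \<times> (real \<times> real)) measure) \<rightarrow>\<^sub>M borel"
      "fst \<in> (borel :: ((real \<times> real) \<times> (real \<times> real)) measure) \<rightarrow>\<^sub>M borel"
      "snd \<in> (borel :: ((real \<times> real) \<times> (real \<times> real)) measure) \<rightarrow>\<^sub>M borel"
      "(\<lambda>(v, v'). ennreal ((norm (v - v'))\<^sup>2)) \<in> borel_measurable (borel :: ((real \<times> real) \<times> (real \<times> real)) measure)"
      unfolding case_prod_beta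
      by (auto intro!: borel_measurable_continuous_onI continuous_intros measurable_compose[OF _ measurable_ennreal])
    show "\<exists>\<pi>'\<in>couplings \<nu> \<mu>. (\<integral>\<^sup>+ (v, v'). ennreal ((norm (v - v'))\<^sup>2) \<partial>\<pi>')
        \<le> (\<integral>\<^sup>+ (v, v'). ennreal ((norm (v - v'))\<^sup>2) \<partial>\<pi>)"
    proof
      show "distr \<pi> borel (\<lambda>z. (snd z, fst z)) \<in> couplings \<nu> \<mu>"
        using pi by (auto simp: couplings_def distr_distr comp_def intro!: prob_space_distr)
      show "(\<integral>\<^sup>+ (v, v'). ennreal ((norm (v - v'))\<^sup>2) \<partial>distr \<pi> borel (\<lambda>z. (snd z, fst z)))
        \<le> (\<integral>\<^sup>+ (v, v'). ennreal ((norm (v - v'))\<^sup>2) \<partial>\<pi>)"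
        by (subst nn_integral_distr) (auto simp: case_prod_unfold norm_minus_commute)
    qed
  qed
  show ?thesis
    unfolding wasserstein2_def by (intro arg_cong[of _ _ "\<lambda>x. sqrt (enn2real x)"] antisym le)
qed

text \<open>The map \<open>x \<mapsto> iexp (t * x)\<close> is Lipschitz with constant
  \<open>\<bar>t\<bar>\<close>, and the mean of \<open>\<bar>X - Y\<bar>\<close> is at most its root
  mean square. So a small transport excess forces nearby laws, and no optimal coupling has to
  exist.\<close>

lemma norm_char_diff_le:
  assumes "prob_space M" and [measurable]: "X \<in> borel_measurable M" "Y \<in> borel_measurable M"
    and int: "integrable M (\<lambda>z. (X z - Y z)\<^sup>2)"
  shows "cmod (char (distr M borel X) t - char (distr M borel Y) t) \<le> \<bar>t\<bar> * sqrt (\<integral>z. (X z - Y z)\<^sup>2 \<partial>M)"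
proof -
  interpret prob_space M by fact
  have intd: "integrable M (\<lambda>z. X z - Y z)"
    by (rule square_integrable_imp_integrable[OF _ int]) auto
  have int_exp: "integrable M (\<lambda>z. iexp (t * X z))" "integrable M (\<lambda>z. iexp (t * Y z))"
    by (auto intro!: integrable_iexp simp del: of_real_mult)
  have char: "char (distr M borel Z) t = (CLINT z|M. iexp (t * Z z))" if "Z \<in> borel_measurable M" for Z
    unfolding char_def using that by (subst integral_distr) auto
  have "char (distr M borel X) t - char (distr M borel Y) t = (CLINT z|M. iexp (t * X z) - iexp (t * Y z))"
    by (simp only: char assms(2,3) Bochner_Integration.integral_diff int_exp)
  also have "cmod \<dots> \<le> (\<integral>z. cmod (iexp (t * X z) - iexp (t * Y z)) \<partial>M)"
    by (rule integral_norm_bound)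
  also have "\<dots> \<le> (\<integral>z. \<bar>t\<bar> * \<bar>X z - Y z\<bar> \<partial>M)"
  proof (rule integral_mono)
    fix z
    have "iexp (t * X z) - iexp (t * Y z) = iexp (t * Y z) * (iexp (t * (X z - Y z)) - 1)"
      by (simp add: algebra_simps exp_add[symmetric])
    then have "cmod (iexp (t * X z) - iexp (t * Y z)) = cmod (iexp (t * (X z - Y z)) - 1)"
      by (simp only: norm_mult norm_exp_i_times mult_1_left)
    also have "\<dots> \<le> \<bar>t * (X z - Y z)\<bar>"
      using iexp_approx1[of "t * (X z - Y z)" 0] by simp
    finally show "cmod (iexp (t * X z) - iexp (t * Y z)) \<le> \<bar>t\<bar> * \<bar>X z - Y z\<bar>"
      by (simp add: abs_mult)
  qed (use intd int_exp in \<open>auto simp del: of_real_mult\<close>)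
  also have "\<dots> = \<bar>t\<bar> * (\<integral>z. \<bar>X z - Y z\<bar> \<partial>M)" by simp
  \<comment> \<open>This is nonnegativity of the variance of
    \<open>\<bar>X - Y\<bar>\<close>.\<close>
  also have "(\<integral>z. \<bar>X z - Y z\<bar> \<partial>M) \<le> sqrt (\<integral>z. (X z - Y z)\<^sup>2 \<partial>M)"
    using variance_positive[of "\<lambda>z. \<bar>X z - Y z\<bar>"] int intd
    by (intro real_le_rsqrt) (simp add: variance_eq)
  finally show ?thesis by (simp add: mult_left_mono)
qed

text \<open>
  The term \<open>2/3 + s E (X Y)\<close> is \<open>E A\<^sup>2 + 1/3\<close> for \<open>A = (X + s Y) / \<surd>2\<close>.
\<close>

lemma coupling_cost:
  fixes s :: real
  assumes s: "s\<^sup>2 = 1" and P: "P \<in> permutons" and pi: "\<pi> \<in> couplings (line_permuton s) P"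
  shows "integrable \<pi> (\<lambda>z. (diagonal_coord s (snd z) - fst (fst z))\<^sup>2)"
    and "(\<integral>\<^sup>+ (v, v'). ennreal ((norm (v - v'))\<^sup>2) \<partial>\<pi>) = ennreal (4 / 3 - sqrt 2 * (2 / 3 + s * (\<integral>z. fst z * snd z \<partial>P))
      + sqrt 2 * (\<integral>z. (diagonal_coord s (snd z) - fst (fst z))\<^sup>2 \<partial>\<pi>))"
    and "0 \<le> 4 / 3 - sqrt 2 * (2 / 3 + s * (\<integral>z. fst z * snd z \<partial>P))
      + sqrt 2 * (\<integral>z. (diagonal_coord s (snd z) - fst (fst z))\<^sup>2 \<partial>\<pi>)"
proof -
  have [simp, measurable_cong]: "sets \<pi> = sets borel" and "prob_space \<pi>"
    and dfst: "distr \<pi> borel fst = line_permuton s" and dsnd: "distr \<pi> borel snd = P"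
    using pi by (auto simp: couplings_def)
  then interpret prob_space \<pi> by simp
  have [simp, measurable_cong]: "sets P = sets borel" using P by (simp add: permutons_def)
  have [measurable]:
    "fst \<in> (borel :: ((real \<times> real) \<times> (real \<times> real)) measure) \<rightarrow>\<^sub>M borel"
    "snd \<in> (borel :: ((real \<times> real) \<times> (real \<times> real)) measure) \<rightarrow>\<^sub>M borel"
    by (auto intro!: borel_measurable_continuous_onI continuous_intros)
  define U X Y where "U z = fst (fst z)" and "X z = fst (snd z)" and "Y z = snd (snd z)"
    for z :: "(real \<times> real) \<times> (real \<times> real)"
  have [measurable]: "U \<in> borel_measurable borel" "X \<in> borel_measurable borel" "Y \<in> borel_measurable borel"
    unfolding U_def X_def Y_def by measurable
  have "distr (line_permuton s) borel fst = unif"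
    unfolding line_permuton_def by (subst distr_distr) (auto simp: comp_def distr_id2)
  moreover have "distr (distr \<pi> borel fst) borel fst = distr \<pi> borel U"
    by (subst distr_distr) (auto simp: comp_def U_def[abs_def])
  moreover have "distr (distr \<pi> borel snd) borel fst = distr \<pi> borel X"
    by (subst distr_distr) (auto simp: comp_def X_def[abs_def])
  moreover have "distr (distr \<pi> borel snd) borel snd = distr \<pi> borel Y"
    by (subst distr_distr) (auto simp: comp_def Y_def[abs_def])
  ultimately have law: "distr \<pi> borel U = unif" "distr \<pi> borel X = unif" "distr \<pi> borel Y = unif"
    using P by (simp_all add: dfst dsnd permutons_def)
  have bound: "AE z in \<pi>. \<bar>F z\<bar> \<le> 1" if "distr \<pi> borel F = unif" "F \<in> borel_measurable borel" for F
  proof -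
    have "AE x in distr \<pi> borel F. \<bar>x\<bar> \<le> 1"
      unfolding that(1) by (rule AE_unif)
    then show ?thesis
      using that(2) by (subst (asm) AE_distr_iff) auto
  qed
  have sq: "(\<integral>z. (F z)\<^sup>2 \<partial>\<pi>) = 1 / 3" if "distr \<pi> borel F = unif" "F \<in> borel_measurable borel" for F
  proof -
    have "(\<integral>z. (F z)\<^sup>2 \<partial>\<pi>) = (\<integral>x. x\<^sup>2 \<partial>distr \<pi> borel F)"
      using that(2) by (subst integral_distr) auto
    then show ?thesis
      unfolding that(1) by (simp only: integral_unif_power2)
  qed
  have prod: "integrable \<pi> (\<lambda>z. F z * G z)" if "distr \<pi> borel F = unif" "F \<in> borel_measurable borel"
    "distr \<pi> borel G = unif" "G \<in> borel_measurable borel" for F G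
  proof (rule integrable_const_bound)
    show "AE z in \<pi>. norm (F z * G z) \<le> 1"
      using bound[OF that(1,2)] bound[OF that(3,4)]
    proof eventually_elim
      case (elim z)
      then show ?case using mult_mono[of "\<bar>F z\<bar>" 1 "\<bar>G z\<bar>" 1] by (simp add: abs_mult)
    qed
  qed (use that in auto)
  have [simp]: "integrable \<pi> (\<lambda>z. (U z)\<^sup>2)" "integrable \<pi> (\<lambda>z. (X z)\<^sup>2)" "integrable \<pi> (\<lambda>z. (Y z)\<^sup>2)"
    "integrable \<pi> (\<lambda>z. X z * Y z)" "integrable \<pi> (\<lambda>z. U z * X z)" "integrable \<pi> (\<lambda>z. U z * Y z)"
    unfolding power2_eq_square by (auto intro!: prod law)
  let ?D = "\<lambda>z. (diagonal_coord s (snd z) - fst (fst z))\<^sup>2"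
  have D: "?D z = (X z)\<^sup>2 / 2 + (Y z)\<^sup>2 / 2 + s * (X z * Y z) + (U z)\<^sup>2 - sqrt 2 * (U z * X z) - sqrt 2 * s * (U z * Y z)" for z
  proof -
    have "?D z = (X z + s * Y z)\<^sup>2 / 2 + (U z)\<^sup>2 - 2 * ((X z + s * Y z) / sqrt 2) * U z"
      by (simp add: diagonal_coord_def U_def X_def Y_def power2_diff power_divide)
    also have "2 * ((X z + s * Y z) / sqrt 2) = sqrt 2 * (X z + s * Y z)"
      by (simp add: field_simps)
    finally show ?thesis
      using s by (simp add: power2_sum power_mult_distrib algebra_simps add_divide_distrib)
  qed
  show intD: "integrable \<pi> ?D"
    unfolding D by simp
  \<comment> \<open>Completing the square: the cross terms of \<open>U\<close> with \<open>X\<close>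
    and \<open>Y\<close> are absorbed into \<open>sqrt 2 * ?D z\<close>. The means of the remaining
    terms depend only on the uniform marginals and on the mean of \<open>X * Y\<close> under
    \<open>P\<close>.\<close>
  define C where "C z = (2 - sqrt 2) * (U z)\<^sup>2 + (1 - sqrt 2 / 2) * (X z)\<^sup>2 + (1 - sqrt 2 / 2) * (Y z)\<^sup>2
      - sqrt 2 * s * (X z * Y z) + sqrt 2 * ?D z" for z
  have C: "C z = (U z - X z)\<^sup>2 + (s * U z - Y z)\<^sup>2" for z
  proof -
    have "C z = 2 * (U z)\<^sup>2 + (X z)\<^sup>2 + (Y z)\<^sup>2 - (sqrt 2 * sqrt 2) * (U z * X z) - (sqrt 2 * sqrt 2) * s * (U z * Y z)"
      unfolding C_def D by (simp add: algebra_simps del: real_sqrt_mult_self)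
    also have "\<dots> = (U z)\<^sup>2 + s\<^sup>2 * (U z)\<^sup>2 + (X z)\<^sup>2 + (Y z)\<^sup>2 - 2 * (U z * X z) - 2 * s * (U z * Y z)"
      by (simp add: s)
    finally show ?thesis
      by (simp add: power2_diff power_mult_distrib algebra_simps)
  qed
  have intC: "integrable \<pi> C"
    unfolding C_def using intD by simp
  have "(\<integral>z. fst z * snd z \<partial>P) = (\<integral>z. X z * Y z \<partial>\<pi>)"
    unfolding dsnd[symmetric] X_def Y_def by (subst integral_distr) auto
  then have EC: "(\<integral>z. C z \<partial>\<pi>) = 4 / 3 - sqrt 2 * (2 / 3 + s * (\<integral>z. fst z * snd z \<partial>P)) + sqrt 2 * (\<integral>z. ?D z \<partial>\<pi>)"
    unfolding C_def using intD by (simp add: sq law) (simp add: algebra_simps diff_divide_distrib)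
  \<comment> \<open>The first point of the coupling lies on the line almost surely, so the squared
    distance may be replaced by \<open>C\<close>.\<close>
  have "AE w in line_permuton s. snd w = s * fst w"
    unfolding line_permuton_def by (subst AE_distr_iff) (auto simp: pred_def)
  then have "AE z in \<pi>. snd (fst z) = s * U z"
    unfolding dfst[symmetric] U_def by (subst (asm) AE_distr_iff) auto
  then have "(\<integral>\<^sup>+ (v, v'). ennreal ((norm (v - v'))\<^sup>2) \<partial>\<pi>) = (\<integral>\<^sup>+z. ennreal (C z) \<partial>\<pi>)"
    by (intro nn_integral_cong_AE, eventually_elim)
      (auto simp: C norm_prod_def U_def X_def Y_def)
  also have "\<dots> = ennreal (\<integral>z. C z \<partial>\<pi>)"
    by (rule nn_integral_eq_integral[OF intC]) (simp add: C)
  finally show "(\<integral>\<^sup>+ (v, v'). ennreal ((norm (v - v'))\<^sup>2) \<partial>\<pi>) = ennreal (4 / 3 - sqrt 2 * (2 / 3 + s * (\<integral>z. fst z * snd z \<partial>P))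
      + sqrt 2 * (\<integral>z. ?D z \<partial>\<pi>))"
    by (simp add: EC)
  \<comment> \<open>Since \<open>ennreal\<close> cuts negative reals off at 0, nonnegativity is
    recorded so that costs can later be compared as reals.\<close>
  have "0 \<le> (\<integral>z. C z \<partial>\<pi>)" by (simp add: C)
  then show "0 \<le> 4 / 3 - sqrt 2 * (2 / 3 + s * (\<integral>z. fst z * snd z \<partial>P)) + sqrt 2 * (\<integral>z. ?D z \<partial>\<pi>)"
    by (simp add: EC)
qed

text \<open>The product measure is a coupling. It provides a member whose finite cost bounds the
  infimum.\<close>

lemma couplings_nonempty:
  assumes "prob_space \<mu>" "prob_space \<nu>" and [simp]: "sets \<mu> = sets borel" "sets \<nu> = sets borel"
  shows "couplings \<mu> \<nu> \<noteq> {}"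
proof -
  interpret M: prob_space \<mu> by fact
  interpret N: prob_space \<nu> by fact
  interpret pair_prob_space \<mu> \<nu> ..
  have [simp]: "space \<mu> = UNIV"
    using sets_eq_imp_space_eq[OF assms(3)] by simp
  have "sets (\<mu> \<Otimes>\<^sub>M \<nu>) = sets (borel \<Otimes>\<^sub>M borel :: ((real \<times> real) \<times> (real \<times> real)) measure)"
    by (intro sets_pair_measure_cong) auto
  then have "sets (\<mu> \<Otimes>\<^sub>M \<nu>) = sets borel"
    by (simp only: borel_prod)
  moreover have "distr (\<mu> \<Otimes>\<^sub>M \<nu>) borel fst = \<mu>"
    using N.distr_pair_fst[of \<mu>] by (simp cong: distr_cong)
  moreover have "distr (\<mu> \<Otimes>\<^sub>M \<nu>) borel snd = \<nu>"
  proof (rule measure_eqI)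
    fix A assume "A \<in> sets (distr (\<mu> \<Otimes>\<^sub>M \<nu>) borel snd)"
    then have A: "A \<in> sets borel" by simp
    then have "emeasure (distr (\<mu> \<Otimes>\<^sub>M \<nu>) borel snd) A = emeasure (\<mu> \<Otimes>\<^sub>M \<nu>) (space \<mu> \<times> A)"
      using sets.sets_into_space[of A \<nu>] measurable_snd[of \<mu> \<nu>] measurable_cong_sets[OF refl assms(4)]
      by (subst emeasure_distr) (auto simp: space_pair_measure intro!: arg_cong2[where f = emeasure])
    then show "emeasure (distr (\<mu> \<Otimes>\<^sub>M \<nu>) borel snd) A = emeasure \<nu> A"
      using A N.emeasure_pair_measure_Times[of "space \<mu>" \<mu> A] by (simp add: M.emeasure_space_1[simplified])
  qed simp
  ultimately have "\<mu> \<Otimes>\<^sub>M \<nu> \<in> couplings \<mu> \<nu>"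
    by (simp add: couplings_def prob_space_axioms)
  then show ?thesis by blast
qed

text \<open>\<open>c\<close> is the part of the cost common to all couplings; the rest is
  \<open>sqrt 2\<close> times the mean square of the diagonal coordinate minus \<open>U\<close>. Its
  infimum is 0 exactly if that coordinate is uniform: then it can itself be taken as
  \<open>U\<close>, and conversely nearly optimal couplings bring the characteristic functions
  arbitrarily close.\<close>

lemma wasserstein2_line_permuton:
  fixes s :: real
  assumes s: "s\<^sup>2 = 1" and P: "P \<in> permutons"
  defines "c \<equiv> 4 / 3 - sqrt 2 * (2 / 3 + s * (\<integral>z. fst z * snd z \<partial>P))"
  shows "c \<le> (wasserstein2 (line_permuton s) P)\<^sup>2"
    and "(wasserstein2 (line_permuton s) P)\<^sup>2 = c \<longleftrightarrow> distr P borel (diagonal_coord s) = unif"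
proof -
  have [simp, measurable_cong]: "sets P = sets borel" and "prob_space P"
    using P by (auto simp: permutons_def)
  then interpret P: prob_space P by simp
  have [measurable]:
    "fst \<in> (borel :: ((real \<times> real) \<times> (real \<times> real)) measure) \<rightarrow>\<^sub>M borel"
    "snd \<in> (borel :: ((real \<times> real) \<times> (real \<times> real)) measure) \<rightarrow>\<^sub>M borel"
    by (auto intro!: borel_measurable_continuous_onI continuous_intros)
  let ?C = "couplings (line_permuton s) P"
  let ?cost = "\<lambda>\<pi>. \<integral>\<^sup>+ (v, v'). ennreal ((norm (v - v'))\<^sup>2) \<partial>\<pi>"
  let ?D = "\<lambda>\<pi>. \<integral>z. (diagonal_coord s (snd z) - fst (fst z))\<^sup>2 \<partial>\<pi>"
  define W where "W = (INF \<pi>\<in>?C. ?cost \<pi>)"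
  note cost = coupling_cost(2)[OF s P, folded c_def] and nonneg = coupling_cost(3)[OF s P, folded c_def]
  have W2: "(wasserstein2 (line_permuton s) P)\<^sup>2 = enn2real W"
    by (simp add: wasserstein2_def W_def)
  obtain \<pi>0 where pi0: "\<pi>0 \<in> ?C"
    using couplings_nonempty[OF prob_space_line_permuton \<open>prob_space P\<close>, of s] by auto
  have "W \<le> ?cost \<pi>0"
    unfolding W_def by (rule INF_lower[OF pi0])
  then have fin: "W < \<infinity>"
    unfolding cost[OF pi0] by (rule le_less_trans) simp
  have D_nonneg: "0 \<le> ?D \<pi>" for \<pi> by (rule Bochner_Integration.integral_nonneg) simp
  have "ennreal c \<le> W"
    unfolding W_def
  proof (rule INF_greatest)
    fix \<pi> assume "\<pi> \<in> ?C"
    then show "ennreal c \<le> ?cost \<pi>"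
      using D_nonneg[of \<pi>] by (simp add: cost ennreal_leI)
  qed
  then have "enn2real (ennreal c) \<le> enn2real W"
    using fin by (intro enn2real_mono) auto
  \<comment> \<open>The sign of \<open>c\<close> is not known here; truncation at 0 can only
    increase it.\<close>
  moreover have "c \<le> enn2real (ennreal c)"
    by (cases "0 \<le> c") (auto simp: ennreal_neg)
  ultimately show le: "c \<le> (wasserstein2 (line_permuton s) P)\<^sup>2"
    unfolding W2 by linarith
  show "(wasserstein2 (line_permuton s) P)\<^sup>2 = c \<longleftrightarrow> distr P borel (diagonal_coord s) = unif"
  proof
    assume unif: "distr P borel (diagonal_coord s) = unif"
    \<comment> \<open>Send each point to its orthogonal projection onto the line, stretched by
      \<open>sqrt 2\<close>, so that \<open>U\<close> equals the diagonal coordinate and the excess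
      is 0.\<close>
    let ?f = "\<lambda>z. ((diagonal_coord s z, s * diagonal_coord s z), z)"
    have [measurable]: "?f \<in> borel \<rightarrow>\<^sub>M borel"
      unfolding diagonal_coord_def by (auto intro!: borel_measurable_continuous_onI continuous_intros)
    have "distr P borel (\<lambda>z. (diagonal_coord s z, s * diagonal_coord s z)) = line_permuton s"
      unfolding line_permuton_def unif[symmetric] by (subst distr_distr) (auto simp: comp_def)
    then have "distr P borel ?f \<in> ?C"
      by (auto simp: couplings_def distr_distr comp_def intro!: P.prob_space_distr distr_id2)
    moreover have "?D (distr P borel ?f) = 0"
      by (subst integral_distr) auto
    ultimately have "W \<le> ennreal c" "0 \<le> c"
      using INF_lower[of "distr P borel ?f" ?C ?cost] cost[of "distr P borel ?f"] nonneg[of "distr P borel ?f"]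
      by (auto simp: W_def)
    then have "enn2real W \<le> c"
      by (metis enn2real_ennreal enn2real_mono ennreal_less_top)
    then show "(wasserstein2 (line_permuton s) P)\<^sup>2 = c"
      using le unfolding W2 by linarith
  next
    assume eq: "(wasserstein2 (line_permuton s) P)\<^sup>2 = c"
    \<comment> \<open>Finiteness of \<open>W\<close> matters, because \<open>enn2real\<close> maps
      infinity to 0.\<close>
    then have Wc: "W = ennreal c" "0 \<le> c"
      using fin unfolding W2 by auto
    have close: "cmod (char (distr P borel (diagonal_coord s)) t - char unif t) \<le> \<bar>t\<bar> * sqrt \<epsilon>"
      if "\<epsilon> > 0" for t \<epsilon>
    proof -
      have "W < ennreal (c + sqrt 2 * \<epsilon>)"
        unfolding Wc using that Wc(2) by (intro ennreal_lessI) (auto intro: add_nonneg_pos)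
      then obtain \<pi> where pi: "\<pi> \<in> ?C" and "?cost \<pi> < ennreal (c + sqrt 2 * \<epsilon>)"
        unfolding W_def by (auto simp: INF_less_iff)
      then have "c + sqrt 2 * ?D \<pi> < c + sqrt 2 * \<epsilon>"
        unfolding cost[OF pi] by (simp add: ennreal_less_iff nonneg[OF pi])
      then have D: "?D \<pi> \<le> \<epsilon>" by simp
      have [simp, measurable_cong]: "sets \<pi> = sets borel" and "prob_space \<pi>"
        and dfst: "distr \<pi> borel fst = line_permuton s" and dsnd: "distr \<pi> borel snd = P"
        using pi by (auto simp: couplings_def)
      have "distr (distr \<pi> borel snd) borel (diagonal_coord s) = distr \<pi> borel (\<lambda>z. diagonal_coord s (snd z))"
        by (subst distr_distr) (auto simp: comp_def)
      then have 1: "distr P borel (diagonal_coord s) = distr \<pi> borel (\<lambda>z. diagonal_coord s (snd z))"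
        by (simp add: dsnd)
      have "distr (distr \<pi> borel fst) borel fst = distr \<pi> borel (\<lambda>z. fst (fst z))"
        by (subst distr_distr) (auto simp: comp_def)
      moreover have "distr (line_permuton s) borel fst = unif"
        unfolding line_permuton_def by (subst distr_distr) (auto simp: comp_def distr_id2)
      ultimately have 2: "unif = distr \<pi> borel (\<lambda>z. fst (fst z))"
        by (simp add: dfst)
      have "cmod (char (distr P borel (diagonal_coord s)) t - char unif t) \<le> \<bar>t\<bar> * sqrt (?D \<pi>)"
        unfolding 1 2 using coupling_cost(1)[OF s P pi] \<open>prob_space \<pi>\<close>
        by (intro norm_char_diff_le) auto
      also have "\<dots> \<le> \<bar>t\<bar> * sqrt \<epsilon>"
        using D by (intro mult_left_mono) auto
      finally show ?thesis .
    qed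
    have "char (distr P borel (diagonal_coord s)) t = char unif t" for t
    proof (rule ccontr)
      let ?d = "cmod (char (distr P borel (diagonal_coord s)) t - char unif t)"
      assume "char (distr P borel (diagonal_coord s)) t \<noteq> char unif t"
      then have d: "?d > 0" by simp
      \<comment> \<open>This choice of \<open>\<epsilon>\<close> makes the bound
        \<open>\<bar>t\<bar> / (\<bar>t\<bar> + 1)\<close> times \<open>?d\<close>, which is less
        than \<open>?d\<close>; the added 1 also covers \<open>t = 0\<close>.\<close>
      have "?d \<le> \<bar>t\<bar> * sqrt ((?d / (\<bar>t\<bar> + 1))\<^sup>2)"
        using d by (intro close) auto
      also have "\<dots> = (\<bar>t\<bar> / (\<bar>t\<bar> + 1)) * ?d" by simp
      also have "\<dots> < 1 * ?d"
        using d by (intro mult_strict_right_mono) auto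
      finally show False by simp
    qed
    then show "distr P borel (diagonal_coord s) = unif"
      by (intro Levy_uniqueness)
        (auto intro!: real_distribution.intro real_distribution_axioms.intro P.prob_space_distr prob_space_unif)
  qed
qed

section \<open>The minimum value and the measures that attain it\<close>

theorem theorem4:
  shows "(\<forall>P\<in>permutons.
            is_arg_min detour_cost (\<lambda>Q. Q \<in> permutons) P \<longleftrightarrow>
            distr P borel (\<lambda>(x, y). ((x - y) / sqrt 2, (x + y) / sqrt 2)) \<in> permutons)
       \<and> is_arg_min detour_cost (\<lambda>Q. Q \<in> permutons) archimedean_measure
       \<and> (\<exists>Q. is_arg_min detour_cost (\<lambda>P. P \<in> permutons) Q \<and> Q \<noteq> archimedean_measure)"
proof -
  define m where "m = 8 / 3 - 4 / 3 * sqrt 2"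
  have bound: "m \<le> detour_cost P" and
    eq: "detour_cost P = m \<longleftrightarrow> distr P borel (diagonal_coord (-1)) = unif \<and> distr P borel (diagonal_coord 1) = unif"
    if P: "P \<in> permutons" for P
  proof -
    let ?c = "\<lambda>s. 4 / 3 - sqrt 2 * (2 / 3 + s * (\<integral>z. fst z * snd z \<partial>P))"
    have cost: "detour_cost P = (wasserstein2 (line_permuton 1) P)\<^sup>2 + (wasserstein2 (line_permuton (-1)) P)\<^sup>2"
      by (simp add: detour_cost_def id_permuton_eq rev_permuton_eq wasserstein2_commute[of P])
    \<comment> \<open>The mean of \<open>X * Y\<close> enters the two bounds with opposite signs and
      cancels, so \<open>m\<close> does not depend on \<open>P\<close>.\<close>
    have m: "m = ?c 1 + ?c (-1)" by (simp add: m_def algebra_simps)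
    note W = wasserstein2_line_permuton[OF _ P, of 1] wasserstein2_line_permuton[OF _ P, of "-1"]
    have le: "?c 1 \<le> (wasserstein2 (line_permuton 1) P)\<^sup>2" "?c (-1) \<le> (wasserstein2 (line_permuton (-1)) P)\<^sup>2"
      by (rule W; simp)+
    then show "m \<le> detour_cost P" unfolding cost m by linarith
    \<comment> \<open>Each summand is at least its own bound, so the sum is tight only if both
      are.\<close>
    have "detour_cost P = m \<longleftrightarrow> (wasserstein2 (line_permuton 1) P)\<^sup>2 = ?c 1 \<and> (wasserstein2 (line_permuton (-1)) P)\<^sup>2 = ?c (-1)"
      using le unfolding cost m by linarith
    also have "\<dots> \<longleftrightarrow> distr P borel (diagonal_coord 1) = unif \<and> distr P borel (diagonal_coord (-1)) = unif"
      by (intro arg_cong2[of _ _ _ _ "(\<and>)"] W) auto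
    finally show "detour_cost P = m \<longleftrightarrow> distr P borel (diagonal_coord (-1)) = unif \<and> distr P borel (diagonal_coord 1) = unif"
      by blast
  qed
  have arch: "detour_cost archimedean_measure = m"
    by (simp add: eq archimedean_permuton distr_archimedean_diagonal)
  \<comment> \<open>As the Archimedean measure attains the lower bound \<open>m\<close>, minimizing
    means having cost \<open>m\<close>.\<close>
  have arg_min: "is_arg_min detour_cost (\<lambda>Q. Q \<in> permutons) P \<longleftrightarrow> detour_cost P = m"
    if P: "P \<in> permutons" for P
    using bound arch archimedean_permuton P unfolding is_arg_min_def
    by (metis linorder_not_less order_le_less)
  have "detour_cost octant_measure = m"
    by (simp add: eq octant_permuton distr_octant_diagonal)
  then show ?thesis
    using arch arg_min archimedean_permuton octant_permuton octant_measure_neq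
    by (auto simp: rotated_permuton_iff eq)
qed

end
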